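(* Let $G$ be a finitely generated infinite residually finite group with finite periodic asymptotic dimension. Then every $G$-subshift with the finite extension property (FEP) has dense periodic points, i.e. its points with finite-index stabilizer in $G$ form a dense subset of it.
   Context: For a finite set $A$ (alphabet) and a group $G$, $A^G$ carries the product topology (discrete $A$) and the shift action $(gx)_h = x_{g^{-1}h}$. A subshift is a topologically closed, shift-invariant subset $X \subset A^G$. A pattern is an element $p \in A^D$ with $D \subset G$. A pattern $q \in A^W$ with $W$ finite appears in a pattern $p \in A^E$ if for some $g \in G$ with $gW \subset E$ one has $p_{gw} = q_w$ for all $w \in W$. $X$ is a subshift of finite type (SFT) if there are a finite set $W \subset G$ (a window for $X$) and a set $\mathcal{F} \subset A^W$ of forbidden patterns such that $X$ is the set of $x \in A^G$ in which no pattern from $\mathcal{F}$ appears. Given the window $W$, one takes $\mathcal{F}$ to be the set of all patterns in $A^W$ that do not appear in any configuration of $X$. A pattern $p \in A^E$ is locally valid (with respect to $W$) if no element of $\mathcal{F}$ appears in it, and globally valid if $p = x|_E$ for some $x \in X$. An SFT $X \subset A^G$ has the finite extension property (FEP) if for some window $W$ for $X$ there exists a finite set $N \subset G$ with $1_G \in N$ such that for every nonempty $D \subset G$ and every pattern $p \in A^D$: if $p$ is the restriction to $D$ of some locally valid pattern with domain $DN$, then $p$ is globally valid. A configuration is periodic if its stabilizer under the shift action has finite index in $G$. Periodic asymptotic dimension: fix a finite symmetric generating set of $G$ with word norm $|\cdot|$. For $n, r, m \in \mathbb{N}$ let $X_{n,r,m} \subset \{1,\ldots,n\}^G$ be the set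 of $x$ such that for each color $c \in \{1,\ldots,n\}$, the graph with vertex set $\{a \in G : x_a = c\}$ and edges $\{(a,b) : x_a = x_b = c,\ |a^{-1}b| \leq r\}$ has all connected components of cardinality at most $m$. The periodic asymptotic dimension $\mathrm{pdim}(G)$ is the infimum of all $d \in \mathbb{N}$ such that for all $r$ there exists $m$ such that $X_{d+1,r,m}$ contains a periodic point (it is $\infty$ if no such $d$ exists). It does not depend on the choice of finite generating set. *)

theory Defs
  imports
    "HOL-Algebra.Group_Action"
    "HOL-Algebra.Generated_Groups"
    "HOL-Analysis.Analysis"
begin

section \<open>Finite index and residual finiteness\<close>

definition finite_index :: "('g, 'm) monoid_scheme \<Rightarrow> 'g set \<Rightarrow> bool" where
  "finite_index G H \<longleftrightarrow> subgroup H G \<and> finite (rcosets\<^bsub>G\<^esub> H)"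

definition residually_finite :: "('g, 'm) monoid_scheme \<Rightarrow> bool" where
  "residually_finite G \<longleftrightarrow>
    (\<forall>g \<in> carrier G. g \<noteq> \<one>\<^bsub>G\<^esub> \<longrightarrow> (\<exists>K. K \<lhd> G \<and> finite_index G K \<and> g \<notin> K))"

section \<open>Shift action\<close>

text \<open>
  Configurations over an alphabet \<open>A\<close> are the elements of \<open>carrier G \<rightarrow>\<^sub>E A\<close> and patterns with
  domain \<open>D\<close> those of \<open>D \<rightarrow>\<^sub>E A\<close>, so every function below is \<open>undefined\<close> outside its domain
  and equality of functions is equality of patterns.
\<close>

definition shift :: "('g, 'm) monoid_scheme \<Rightarrow> 'g \<Rightarrow> ('g \<Rightarrow> 'a) \<Rightarrow> 'g \<Rightarrow> 'a" where
  "shift G g x = (\<lambda>h \<in> carrier G. x (inv\<^bsub>G\<^esub> g \<otimes>\<^bsub>G\<^esub> h))"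

definition periodic :: "('g, 'm) monoid_scheme \<Rightarrow> ('g \<Rightarrow> 'a) \<Rightarrow> bool" where
  "periodic G x \<longleftrightarrow> finite_index G (stabilizer G (shift G) x)"

definition config_topology :: "('g, 'm) monoid_scheme \<Rightarrow> 'a set \<Rightarrow> ('g \<Rightarrow> 'a) topology" where
  "config_topology G A = product_topology (\<lambda>_. discrete_topology A) (carrier G)"

definition subshift :: "('g, 'm) monoid_scheme \<Rightarrow> 'a set \<Rightarrow> ('g \<Rightarrow> 'a) set \<Rightarrow> bool" where
  "subshift G A X \<longleftrightarrow> closedin (config_topology G A) X \<and>
    (\<forall>g \<in> carrier G. \<forall>x \<in> X. shift G g x \<in> X)"

definition dense_periodic_points ::
  "('g, 'm) monoid_scheme \<Rightarrow> 'a set \<Rightarrow> ('g \<Rightarrow> 'a) set \<Rightarrow> bool" where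
  "dense_periodic_points G A X \<longleftrightarrow>
    subtopology (config_topology G A) X closure_of {x \<in> X. periodic G x} = X"

section \<open>Subshifts of finite type and the finite extension property\<close>

text \<open>The pattern \<open>q\<close> with domain \<open>W\<close> appears in the pattern \<open>p\<close> with domain \<open>E\<close>.\<close>

definition appears ::
  "('g, 'm) monoid_scheme \<Rightarrow> 'g set \<Rightarrow> ('g \<Rightarrow> 'a) \<Rightarrow> 'g set \<Rightarrow> ('g \<Rightarrow> 'a) \<Rightarrow> bool" where
  "appears G W q E p \<longleftrightarrow>
    (\<exists>g \<in> carrier G. g <#\<^bsub>G\<^esub> W \<subseteq> E \<and> (\<forall>w \<in> W. p (g \<otimes>\<^bsub>G\<^esub> w) = q w))"

definition window ::
  "('g, 'm) monoid_scheme \<Rightarrow> 'a set \<Rightarrow> ('g \<Rightarrow> 'a) set \<Rightarrow> 'g set \<Rightarrow> bool" where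
  "window G A X W \<longleftrightarrow> finite W \<and> W \<subseteq> carrier G \<and>
    (\<exists>F \<subseteq> W \<rightarrow>\<^sub>E A. X = {x \<in> carrier G \<rightarrow>\<^sub>E A. \<forall>q \<in> F. \<not> appears G W q (carrier G) x})"

definition SFT :: "('g, 'm) monoid_scheme \<Rightarrow> 'a set \<Rightarrow> ('g \<Rightarrow> 'a) set \<Rightarrow> bool" where
  "SFT G A X \<longleftrightarrow> (\<exists>W. window G A X W)"

definition forbidden ::
  "('g, 'm) monoid_scheme \<Rightarrow> 'a set \<Rightarrow> ('g \<Rightarrow> 'a) set \<Rightarrow> 'g set \<Rightarrow> ('g \<Rightarrow> 'a) set" where
  "forbidden G A X W = {q \<in> W \<rightarrow>\<^sub>E A. \<forall>x \<in> X. \<not> appears G W q (carrier G) x}"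

definition locally_valid ::
  "('g, 'm) monoid_scheme \<Rightarrow> 'a set \<Rightarrow> ('g \<Rightarrow> 'a) set \<Rightarrow> 'g set \<Rightarrow> 'g set \<Rightarrow> ('g \<Rightarrow> 'a) \<Rightarrow> bool" where
  "locally_valid G A X W E p \<longleftrightarrow>
    p \<in> E \<rightarrow>\<^sub>E A \<and> (\<forall>q \<in> forbidden G A X W. \<not> appears G W q E p)"

definition globally_valid :: "('g \<Rightarrow> 'a) set \<Rightarrow> 'g set \<Rightarrow> ('g \<Rightarrow> 'a) \<Rightarrow> bool" where
  "globally_valid X E p \<longleftrightarrow> (\<exists>x \<in> X. p = restrict x E)"

definition FEP :: "('g, 'm) monoid_scheme \<Rightarrow> 'a set \<Rightarrow> ('g \<Rightarrow> 'a) set \<Rightarrow> bool" where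
  "FEP G A X \<longleftrightarrow> SFT G A X \<and>
    (\<exists>W. window G A X W \<and>
      (\<exists>N \<subseteq> carrier G. finite N \<and> \<one>\<^bsub>G\<^esub> \<in> N \<and>
        (\<forall>D \<subseteq> carrier G. D \<noteq> {} \<longrightarrow>
          (\<forall>p \<in> D \<rightarrow>\<^sub>E A.
            (\<exists>p'. locally_valid G A X W (D <#>\<^bsub>G\<^esub> N) p' \<and> p = restrict p' D) \<longrightarrow>
            globally_valid X D p))))"

section \<open>Periodic asymptotic dimension\<close>

definition finite_symmetric_generating_set :: "('g, 'm) monoid_scheme \<Rightarrow> 'g set \<Rightarrow> bool" where
  "finite_symmetric_generating_set G S \<longleftrightarrow>
    finite S \<and> S \<subseteq> carrier G \<and> (\<forall>s \<in> S. inv\<^bsub>G\<^esub> s \<in> S) \<and> generate G S = carrier G"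

definition word_norm :: "('g, 'm) monoid_scheme \<Rightarrow> 'g set \<Rightarrow> 'g \<Rightarrow> nat" where
  "word_norm G S g =
    (LEAST n. \<exists>w. set w \<subseteq> S \<and> length w = n \<and> foldr (\<otimes>\<^bsub>G\<^esub>) w \<one>\<^bsub>G\<^esub> = g)"

definition color_edges ::
  "('g, 'm) monoid_scheme \<Rightarrow> 'g set \<Rightarrow> nat \<Rightarrow> ('g \<Rightarrow> nat) \<Rightarrow> nat \<Rightarrow> ('g \<times> 'g) set" where
  "color_edges G S r x c =
    {(a, b). a \<in> carrier G \<and> b \<in> carrier G \<and> x a = c \<and> x b = c \<and>
      word_norm G S (inv\<^bsub>G\<^esub> a \<otimes>\<^bsub>G\<^esub> b) \<le> r}"

text \<open>
  For symmetric \<open>S\<close> the edge relation is symmetric, so the connected component of a vertex is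
  its image under the reflexive transitive closure.
\<close>

definition bounded_colorings ::
  "('g, 'm) monoid_scheme \<Rightarrow> 'g set \<Rightarrow> nat \<Rightarrow> nat \<Rightarrow> nat \<Rightarrow> ('g \<Rightarrow> nat) set" where
  "bounded_colorings G S n r m =
    {x \<in> carrier G \<rightarrow>\<^sub>E {1..n}. \<forall>c \<in> {1..n}. \<forall>a \<in> {a \<in> carrier G. x a = c}.
      finite ((color_edges G S r x c)\<^sup>* `` {a}) \<and> card ((color_edges G S r x c)\<^sup>* `` {a}) \<le> m}"

definition pdim :: "('g, 'm) monoid_scheme \<Rightarrow> 'g set \<Rightarrow> enat" where
  "pdim G S =
    Inf (enat ` {d. \<forall>r. \<exists>m. \<exists>x \<in> bounded_colorings G S (d + 1) r m. periodic G x})"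

end

theory Submission
  imports Defs
begin

text \<open>
  Let \<open>x\<close> be a point of the subshift and \<open>F\<close> a finite set. A periodic coloring with finite cells
  is invariant under a finite index subgroup, which residual finiteness lets us shrink to a
  subgroup \<open>K\<close> that acts freely on the cells and whose translates of \<open>F\<close> are far apart.
  First copy \<open>x\<close> to the neighborhoods of these translates. Then treat the colors one after the other:
  by the FEP the pattern built so far is globally valid after shrinking its domain, and the values
  of one global extension on a single cell from each \<open>K\<close>-orbit of cells are copied along the
  orbit. Cells of one color are so far apart that every window sees at most one of them, hence the
  new pattern is again locally valid. After the last color the pattern is a \<open>K\<close>-invariant
  configuration that extends \<open>x\<close> on \<open>F\<close>.
\<close>

section \<open>Finite index subgroups\<close>

text \<open>Each nontrivial element of \<open>T\<close> is excluded by a normal subgroup of finite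
  index, and these finitely many subgroups are intersected. Normality is kept for \<open>L\<close>
  alone, since \<open>H\<close> will be the stabilizer of a coloring, which is in general not
  normal.\<close>

lemma (in group) residually_finite_avoid:
  assumes "residually_finite G" "finite_index G H" "finite T" "T \<subseteq> carrier G"
  shows "\<exists>L. L \<lhd> G \<and> finite_index G (H \<inter> L) \<and> L \<inter> T \<subseteq> {\<one>}"
proof -
  have Int: "finite_index G (I \<inter> J)" if "finite_index G I" "finite_index G J" for I J
  proof -
    have sub: "subgroup I G" "subgroup J G" and fin: "finite (rcosets I)" "finite (rcosets J)"
      using that by (auto simp: finite_index_def)
    \<comment> \<open>A coset of the intersection is determined by a pair of cosets, which leaves
      finitely many.\<close>
    have "(I \<inter> J) #> a = (I #> a) \<inter> (J #> a)" if "a \<in> carrier G" for a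
      using that sub[THEN subgroup.mem_carrier] by (auto simp: r_coset_def)
    then have "rcosets (I \<inter> J) \<subseteq> (\<lambda>(C, D). C \<inter> D) ` ((rcosets I) \<times> (rcosets J))"
      by (auto simp: RCOSETS_def)
    then have "finite (rcosets (I \<inter> J))"
      by (rule finite_subset) (simp add: fin)
    then show ?thesis
      using subgroups_Inter_pair[OF sub] by (simp add: finite_index_def)
  qed
  show ?thesis
    using assms(3,4)
  proof (induction T)
    case empty
    have "H \<inter> carrier G = H"
      using assms(2) by (auto simp: finite_index_def dest: subgroup.mem_carrier)
    then show ?case
      using assms(2) normal_invI[OF subgroup_self] by fastforce
  next
    case (insert t T)
    then obtain L where L: "L \<lhd> G" "finite_index G (H \<inter> L)" "L \<inter> T \<subseteq> {\<one>}"
      by auto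
    show ?case
    proof (cases "t = \<one>")
      case True
      then show ?thesis
        using L by blast
    next
      case False
      then obtain M where M: "M \<lhd> G" "finite_index G M" "t \<notin> M"
        using assms(1) insert.prems by (auto simp: residually_finite_def)
      have "finite_index G (H \<inter> (L \<inter> M))"
        using Int[OF L(2) M(2)] by (simp add: Int_assoc)
      moreover have "L \<inter> M \<inter> insert t T \<subseteq> {\<one>}"
        using L M by auto
      ultimately show ?thesis
        using normal_subgroup_intersect[OF L(1) M(1)] by (intro exI[of _ "L \<inter> M"] conjI)
    qed
  qed
qed

section \<open>Extending patterns\<close>

text \<open>
  Total functions in place of patterns: the values of \<open>p\<close> outside \<open>E\<close> are irrelevant, so a pattern
  is passed to a smaller domain without restricting it.
\<close>

definition locally_in ::
  "('g, 'm) monoid_scheme \<Rightarrow> 'a set \<Rightarrow> ('g \<Rightarrow> 'a) set \<Rightarrow> 'g set \<Rightarrow> 'g set \<Rightarrow> ('g \<Rightarrow> 'a) \<Rightarrow> bool" where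
  "locally_in G A X W E p \<longleftrightarrow> p \<in> E \<rightarrow> A \<and>
    (\<forall>g \<in> carrier G. (\<forall>w \<in> W. g \<otimes>\<^bsub>G\<^esub> w \<in> E) \<longrightarrow>
      (\<exists>z \<in> X. \<forall>w \<in> W. p (g \<otimes>\<^bsub>G\<^esub> w) = z (g \<otimes>\<^bsub>G\<^esub> w)))"

text \<open>
  \<open>V\<close> is the union of the cells of one color. All points of a cell have the same mark \<open>\<kappa>\<close>, which is
  the element of \<open>K\<close> that moves the chosen cell of its orbit onto it.
\<close>

lemma (in group) extend_over_cells:
  assumes K: "subgroup K G"
    and X: "X \<subseteq> carrier G \<rightarrow>\<^sub>E A" "\<And>g x. g \<in> carrier G \<Longrightarrow> x \<in> X \<Longrightarrow> shift G g x \<in> X"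
    and sub: "U \<subseteq> carrier G" "V \<subseteq> carrier G" "B \<subseteq> carrier G" "W \<subseteq> carrier G"
    and KU: "\<And>k u. k \<in> K \<Longrightarrow> u \<in> U \<Longrightarrow> k \<otimes> u \<in> U"
    and KV: "\<And>k v. k \<in> K \<Longrightarrow> v \<in> V \<Longrightarrow> k \<otimes> v \<in> V"
    and z: "z \<in> X" "\<And>h. h \<in> U <#> B \<Longrightarrow> z h = p h"
    and p: "\<And>k h. k \<in> K \<Longrightarrow> h \<in> U <#> B \<Longrightarrow> p (k \<otimes> h) = p h"
    and \<kappa>: "\<And>a. a \<in> V \<Longrightarrow> \<kappa> a \<in> K"
      "\<And>k a. k \<in> K \<Longrightarrow> a \<in> V \<Longrightarrow> \<kappa> (k \<otimes> a) = k \<otimes> \<kappa> a"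
      "\<And>a b. a \<in> V \<Longrightarrow> b \<in> V \<Longrightarrow> inv a \<otimes> b \<in> Q \<Longrightarrow> \<kappa> a = \<kappa> b"
    and Q: "\<And>b c. b \<in> B \<Longrightarrow> c \<in> B \<Longrightarrow> b \<otimes> inv c \<in> Q"
      "\<And>b c v w. b \<in> B \<Longrightarrow> c \<in> B \<Longrightarrow> v \<in> W \<Longrightarrow> w \<in> W \<Longrightarrow> b \<otimes> (inv v \<otimes> w) \<otimes> inv c \<in> Q"
  obtains p' where "\<And>h. h \<in> U <#> B \<Longrightarrow> p' h = p h"
    and "\<And>a b. a \<in> V \<Longrightarrow> b \<in> B \<Longrightarrow> p' (a \<otimes> b) = z (inv (\<kappa> a) \<otimes> (a \<otimes> b))"
    and "\<And>k h. k \<in> K \<Longrightarrow> h \<in> (U \<union> V) <#> B \<Longrightarrow> p' (k \<otimes> h) = p' h"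
    and "locally_in G A X W ((U \<union> V) <#> B) p'"
proof -
  note Kc = subgroup.mem_carrier[OF K]
  \<comment> \<open>A point of \<open>V <#> B\<close> may factor in several ways;
    \<open>anchor\<close> picks one factor in \<open>V\<close>. The fact \<open>new\<close> below
    shows that the choice is harmless: two possible factors have displacement in \<open>Q\<close>
    and so carry the same mark.\<close>
  define anchor where "anchor h = (SOME a. a \<in> V \<and> inv a \<otimes> h \<in> B)" for h
  define p' where "p' h = (if h \<in> U <#> B then p h else z (inv (\<kappa> (anchor h)) \<otimes> h))" for h
  have KUB: "k \<otimes> h \<in> U <#> B" if k: "k \<in> K" and h: "h \<in> U <#> B" for k h
  proof -
    obtain u b where "u \<in> U" "b \<in> B" "h = u \<otimes> b"
      using h unfolding set_mult_def by blast
    moreover from this have "k \<otimes> h = (k \<otimes> u) \<otimes> b"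
      using m_assoc[OF Kc[OF k] subsetD[OF sub(1)] subsetD[OF sub(3)]] by simp
    ultimately show ?thesis
      using KU k by (auto simp: set_mult_def)
  qed
  have new_E: "\<exists>a \<in> V. \<exists>b \<in> B. h = a \<otimes> b" if "h \<in> (U \<union> V) <#> B" "h \<notin> U <#> B" for h
    using that unfolding set_mult_def by blast
  have old: "p' h = p h" if "h \<in> U <#> B" for h
    using that by (simp add: p'_def)
  \<comment> \<open>On \<open>U <#> B\<close> the point \<open>z\<close> agrees with the
    \<open>K\<close>-invariant \<open>p\<close>, so all \<open>K\<close>-translates of
    \<open>z\<close> show the same values there. Old and new values can thus be read off a single
    translate.\<close>
  have zold: "z (inv k \<otimes> h) = p' h" if "k \<in> K" "h \<in> U <#> B" for k h
    using that z(2) p KUB subgroup.m_inv_closed[OF K] old by simp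
  have new: "p' (a \<otimes> b) = z (inv (\<kappa> a) \<otimes> (a \<otimes> b))" if a: "a \<in> V" and b: "b \<in> B" for a b
  proof (cases "a \<otimes> b \<in> U <#> B")
    case True
    then show ?thesis
      using zold \<kappa>(1)[OF a] by simp
  next
    case False
    have c: "a \<in> carrier G" "b \<in> carrier G"
      using a b sub by auto
    let ?c = "anchor (a \<otimes> b)"
    have "inv a \<otimes> (a \<otimes> b) \<in> B"
      using c b by (simp add: m_assoc[symmetric])
    then have "\<exists>c. c \<in> V \<and> inv c \<otimes> (a \<otimes> b) \<in> B"
      using a by auto
    from someI_ex[OF this] have anc: "?c \<in> V" "inv ?c \<otimes> (a \<otimes> b) \<in> B"
      unfolding anchor_def by blast+
    have cc: "?c \<in> carrier G"
      using anc sub by auto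
    have "(inv ?c \<otimes> (a \<otimes> b)) \<otimes> inv b = inv ?c \<otimes> a"
      using c cc by (simp add: m_assoc)
    then have "inv ?c \<otimes> a \<in> Q"
      using Q(1)[OF anc(2) b] by simp
    then have "\<kappa> ?c = \<kappa> a"
      using \<kappa>(3) anc a by blast
    then show ?thesis
      using False by (simp add: p'_def)
  qed
  have inv': "p' (k \<otimes> h) = p' h" if k: "k \<in> K" and h: "h \<in> (U \<union> V) <#> B" for k h
  proof (cases "h \<in> U <#> B")
    case True
    then show ?thesis
      using k p KUB old by simp
  next
    case False
    then obtain a b where ab: "a \<in> V" "b \<in> B" "h = a \<otimes> b"
      using new_E[OF h] by blast
    have c: "a \<in> carrier G" "b \<in> carrier G" "k \<in> carrier G" "\<kappa> a \<in> carrier G"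
      using ab sub k Kc \<kappa>(1) by auto
    have "p' (k \<otimes> h) = p' ((k \<otimes> a) \<otimes> b)"
      using ab c by (simp add: m_assoc)
    also have "\<dots> = z (inv (k \<otimes> \<kappa> a) \<otimes> ((k \<otimes> a) \<otimes> b))"
      using new[OF KV[OF k ab(1)] ab(2)] \<kappa>(2)[OF k ab(1)] by simp
    also have "inv (k \<otimes> \<kappa> a) \<otimes> ((k \<otimes> a) \<otimes> b) = inv (\<kappa> a) \<otimes> (inv k \<otimes> (k \<otimes> (a \<otimes> b)))"
      using c by (simp add: inv_mult_group m_assoc)
    also have "inv k \<otimes> (k \<otimes> (a \<otimes> b)) = a \<otimes> b"
      using c by (simp add: m_assoc[symmetric])
    finally show ?thesis
      using new[OF ab(1,2)] ab(3) by simp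
  qed
  have dom: "h \<in> carrier G" if "h \<in> (U \<union> V) <#> B" for h
    using that set_mult_closed[OF Un_least[OF sub(1,2)] sub(3)] by blast
  have zA: "z h \<in> A" if "h \<in> carrier G" for h
    by (rule PiE_mem[OF subsetD[OF X(1) z(1)] that])
  have "p' h \<in> A" if h: "h \<in> (U \<union> V) <#> B" for h
  proof (cases "h \<in> U <#> B")
    case True
    then show ?thesis
      using zA[OF dom[OF h]] z(2) old by simp
  next
    case False
    then obtain a b where ab: "a \<in> V" "b \<in> B" "h = a \<otimes> b"
      using new_E[OF h] by blast
    then have "inv (\<kappa> a) \<otimes> (a \<otimes> b) \<in> carrier G"
      using sub Kc[OF \<kappa>(1)] by (auto intro!: m_closed)
    then show ?thesis
      using new[OF ab(1,2)] ab(3) zA by simp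
  qed
  moreover have "\<exists>y \<in> X. \<forall>w \<in> W. p' (g \<otimes> w) = y (g \<otimes> w)"
    if g: "g \<in> carrier G" and gW: "\<forall>w \<in> W. g \<otimes> w \<in> (U \<union> V) <#> B" for g
  proof -
    \<comment> \<open>One translate of \<open>z\<close> explains the whole window. If some point of
      the window is new, its mark is taken for \<open>k\<close>: by the second condition on
      \<open>Q\<close> all other new points of the window have this mark, and the old points accept
      every \<open>k\<close>.\<close>
    have "\<exists>k \<in> K. \<forall>w \<in> W. p' (g \<otimes> w) = z (inv k \<otimes> (g \<otimes> w))"
    proof (cases "\<exists>v \<in> W. g \<otimes> v \<notin> U <#> B")
      case False
      then show ?thesis
        using zold[OF subgroup.one_closed[OF K]] subgroup.one_closed[OF K]
        by (metis (no_types, lifting))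
    next
      case True
      then obtain v a b where v: "v \<in> W" and ab: "a \<in> V" "b \<in> B" "g \<otimes> v = a \<otimes> b"
        using gW new_E by blast
      have "p' (g \<otimes> w) = z (inv (\<kappa> a) \<otimes> (g \<otimes> w))" if w: "w \<in> W" for w
      proof (cases "g \<otimes> w \<in> U <#> B")
        case True
        then show ?thesis
          using zold \<kappa>(1)[OF ab(1)] by simp
      next
        case False
        then obtain a' b' where ab': "a' \<in> V" "b' \<in> B" "g \<otimes> w = a' \<otimes> b'"
          using new_E[OF bspec[OF gW w]] by blast
        have c: "a \<in> carrier G" "b \<in> carrier G" "a' \<in> carrier G" "b' \<in> carrier G"
          "v \<in> carrier G" "w \<in> carrier G"
          using ab ab' v w sub by auto
        have "a = g \<otimes> v \<otimes> inv b" "a' = g \<otimes> w \<otimes> inv b'"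
          using ab(3) ab'(3) c g by (auto simp: m_assoc)
        then have "inv a \<otimes> a' = b \<otimes> (inv v \<otimes> (inv g \<otimes> (g \<otimes> (w \<otimes> inv b'))))"
          using c g by (simp add: inv_mult_group m_assoc)
        also have "inv g \<otimes> (g \<otimes> (w \<otimes> inv b')) = w \<otimes> inv b'"
          using c g by (simp add: m_assoc[symmetric])
        also have "b \<otimes> (inv v \<otimes> (w \<otimes> inv b')) = b \<otimes> (inv v \<otimes> w) \<otimes> inv b'"
          using c by (simp add: m_assoc)
        finally have "inv a \<otimes> a' \<in> Q"
          using Q(2)[OF ab(2) ab'(2) v w] by simp
        then have "\<kappa> a = \<kappa> a'"
          using \<kappa>(3) ab(1) ab'(1) by blast
        then show ?thesis
          using new[OF ab'(1,2)] ab'(3) by simp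
      qed
      then show ?thesis
        using \<kappa>(1)[OF ab(1)] by blast
    qed
    then obtain k where k: "k \<in> K" "\<forall>w \<in> W. p' (g \<otimes> w) = z (inv k \<otimes> (g \<otimes> w))"
      by blast
    have "p' (g \<otimes> w) = shift G k z (g \<otimes> w)" if "w \<in> W" for w
    proof -
      have "g \<otimes> w \<in> carrier G"
        using that g sub by auto
      then show ?thesis
        using k that by (simp add: shift_def)
    qed
    moreover have "shift G k z \<in> X"
      using X(2) Kc[OF k(1)] z(1) by blast
    ultimately show ?thesis
      by blast
  qed
  ultimately have "locally_in G A X W ((U \<union> V) <#> B) p'"
    unfolding locally_in_def by auto
  with old new inv' show thesis
    by (rule that)
qed

section \<open>Cells\<close>

text \<open>A displacement \<open>inv a \<otimes> b\<close> does not change when \<open>K\<close>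
  moves both points, so \<open>a\<close> need only run through representatives of the finitely many
  right cosets of \<open>K\<close>. Finiteness of the cells thus becomes one finite set for a
  subgroup to avoid.\<close>

lemma (in group) finite_cell_displacements:
  assumes K: "finite_index G K"
    and E: "\<And>k a b. k \<in> K \<Longrightarrow> (a, b) \<in> E \<Longrightarrow> (k \<otimes> a, k \<otimes> b) \<in> E"
      "\<And>a. a \<in> carrier G \<Longrightarrow> finite (E `` {a})" "E `` carrier G \<subseteq> carrier G"
  shows "finite {inv a \<otimes> b |a b. a \<in> carrier G \<and> (a, b) \<in> E}"
proof -
  have sub: "subgroup K G" and fin: "finite (rcosets K)"
    using K by (auto simp: finite_index_def)
  note Kc = subgroup.mem_carrier[OF sub]
  define s where "s C = (SOME a. a \<in> carrier G \<and> a \<in> C)" for C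
  let ?M = "{C \<in> rcosets K. s C \<in> carrier G}"
  let ?T = "\<Union>C \<in> ?M. (\<lambda>b. inv (s C) \<otimes> b) ` (E `` {s C})"
  have "inv a \<otimes> b \<in> ?T" if a: "a \<in> carrier G" and ab: "(a, b) \<in> E" for a b
  proof -
    have b: "b \<in> carrier G"
      using E(3) a ab by auto
    have "\<exists>c. c \<in> carrier G \<and> c \<in> K #> a"
      using a rcos_self[OF a sub] by auto
    from someI_ex[OF this] have s: "s (K #> a) \<in> carrier G" "s (K #> a) \<in> K #> a"
      unfolding s_def by blast+
    then obtain k where k: "k \<in> K" "s (K #> a) = k \<otimes> a"
      by (auto simp: r_coset_def)
    have "inv (k \<otimes> a) \<otimes> (k \<otimes> b) = inv a \<otimes> (inv k \<otimes> (k \<otimes> b))"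
      using Kc[OF k(1)] a b by (simp add: inv_mult_group m_assoc)
    also have "inv k \<otimes> (k \<otimes> b) = b"
      using Kc[OF k(1)] b by (simp add: m_assoc[symmetric])
    finally have "inv a \<otimes> b = inv (s (K #> a)) \<otimes> (k \<otimes> b)"
      using k by simp
    moreover have "(s (K #> a), k \<otimes> b) \<in> E"
      using E(1)[OF k(1) ab] k(2) by simp
    moreover have "K #> a \<in> rcosets K"
      using a by (auto simp: RCOSETS_def)
    ultimately show ?thesis
      using s(1) by blast
  qed
  then have "{inv a \<otimes> b |a b. a \<in> carrier G \<and> (a, b) \<in> E} \<subseteq> ?T"
    by blast
  moreover have "finite ?T"
    using fin E(2) by simp
  ultimately show ?thesis
    by (rule finite_subset)
qed

text \<open>Pick one base point for each \<open>K\<close>-orbit of cells. As the action on cells is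
  free, exactly one element of \<open>K\<close> carries the base point into the cell of
  \<open>a\<close>, and this is the mark of \<open>a\<close>.\<close>

lemma (in group) cell_marking:
  assumes K: "subgroup K G"
    and E: "refl E" "sym E" "trans E"
      "\<And>k a b. k \<in> K \<Longrightarrow> (a, b) \<in> E \<Longrightarrow> (k \<otimes> a, k \<otimes> b) \<in> E"
    and free: "\<And>k a. k \<in> K \<Longrightarrow> a \<in> carrier G \<Longrightarrow> (a, k \<otimes> a) \<in> E \<Longrightarrow> k = \<one>"
  obtains \<kappa> where "\<And>a. a \<in> carrier G \<Longrightarrow> \<kappa> a \<in> K"
    and "\<And>k a. k \<in> K \<Longrightarrow> a \<in> carrier G \<Longrightarrow> \<kappa> (k \<otimes> a) = k \<otimes> \<kappa> a"
    and "\<And>a b. a \<in> carrier G \<Longrightarrow> b \<in> carrier G \<Longrightarrow> (a, b) \<in> E \<Longrightarrow> \<kappa> a = \<kappa> b"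
proof -
  note Kc = subgroup.mem_carrier[OF K] and Ki = subgroup.m_inv_closed[OF K]
    and Km = subgroup.m_closed[OF K]
  \<comment> \<open>\<open>R a\<close> collects the points that \<open>K\<close> can move into the
    cell of \<open>a\<close>. This set is the same along a whole orbit of cells, so a choice that
    depends only on the set gives a common base point.\<close>
  define R where "R a = {b \<in> carrier G. \<exists>k \<in> K. (k \<otimes> b, a) \<in> E}" for a
  define t where "t a = (SOME b. b \<in> R a)" for a
  define \<kappa> where "\<kappa> a = (SOME k. k \<in> K \<and> (k \<otimes> t a, a) \<in> E)" for a
  have t: "t a \<in> R a" if "a \<in> carrier G" for a
  proof -
    have "(\<one> \<otimes> a, a) \<in> E"
      using E(1) that by (auto simp: refl_on_def)
    then have "a \<in> R a"
      using that subgroup.one_closed[OF K] unfolding R_def by blast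
    then show ?thesis
      unfolding t_def by (rule someI)
  qed
  have \<kappa>: "\<kappa> a \<in> K" "(\<kappa> a \<otimes> t a, a) \<in> E" if "a \<in> carrier G" for a
  proof -
    have "\<exists>k. k \<in> K \<and> (k \<otimes> t a, a) \<in> E"
      using t[OF that] by (auto simp: R_def)
    from someI_ex[OF this] show "\<kappa> a \<in> K" "(\<kappa> a \<otimes> t a, a) \<in> E"
      unfolding \<kappa>_def by blast+
  qed
  have uniq: "k = l" if "k \<in> K" "l \<in> K" "b \<in> carrier G" "(k \<otimes> b, a) \<in> E" "(l \<otimes> b, a) \<in> E"
    for k l a b
  proof -
    have "(k \<otimes> b, l \<otimes> b) \<in> E"
      using that(4,5) E(2,3) by (meson symD transD)
    then have "(inv k \<otimes> (k \<otimes> b), inv k \<otimes> (l \<otimes> b)) \<in> E"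
      using E(4) Ki that(1) by blast
    then have "(b, (inv k \<otimes> l) \<otimes> b) \<in> E"
      using that Kc by (simp add: m_assoc[symmetric])
    then have "inv k \<otimes> l = \<one>"
      by (rule free[OF Km[OF Ki[OF that(1)] that(2)] that(3)])
    then show ?thesis
      using Kc that by (metis inv_closed inv_equality inv_inv)
  qed
  have R_E: "R a = R b" if "(a, b) \<in> E" for a b
    using that E(2,3) unfolding R_def by (blast dest: symD transD)
  have R_sub: "R a \<subseteq> R (k \<otimes> a)" if "k \<in> K" for k a
  proof
    fix b assume "b \<in> R a"
    then obtain l where l: "b \<in> carrier G" "l \<in> K" "(l \<otimes> b, a) \<in> E"
      by (auto simp: R_def)
    then have "((k \<otimes> l) \<otimes> b, k \<otimes> a) \<in> E"
      using E(4)[OF that l(3)] that Kc by (simp add: m_assoc)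
    then show "b \<in> R (k \<otimes> a)"
      using l that Km by (auto simp: R_def)
  qed
  have R_K: "R (k \<otimes> a) = R a" if "k \<in> K" "a \<in> carrier G" for k a
  proof
    have "inv k \<otimes> (k \<otimes> a) = a"
      using that Kc by (simp add: m_assoc[symmetric])
    then show "R (k \<otimes> a) \<subseteq> R a"
      using R_sub[of "inv k" "k \<otimes> a"] Ki that by simp
  qed (rule R_sub[OF that(1)])
  have tc: "t a \<in> carrier G" if "a \<in> carrier G" for a
    using t[OF that] by (simp add: R_def)
  show thesis
  proof (rule that[of \<kappa>])
    fix k a assume ka: "k \<in> K" "a \<in> carrier G"
    have ka': "k \<otimes> a \<in> carrier G"
      using ka Kc by simp
    have "t (k \<otimes> a) = t a"
      using R_K[OF ka] by (simp add: t_def)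
    then have "(\<kappa> (k \<otimes> a) \<otimes> t a, k \<otimes> a) \<in> E"
      using \<kappa>(2)[OF ka'] by simp
    moreover have "((k \<otimes> \<kappa> a) \<otimes> t a, k \<otimes> a) \<in> E"
      using E(4)[OF ka(1) \<kappa>(2)[OF ka(2)]] Kc ka \<kappa>(1)[OF ka(2)] tc[OF ka(2)]
      by (simp add: m_assoc)
    ultimately show "\<kappa> (k \<otimes> a) = k \<otimes> \<kappa> a"
      by (rule uniq[OF \<kappa>(1)[OF ka'] Km[OF ka(1) \<kappa>(1)[OF ka(2)]] tc[OF ka(2)]])
  next
    fix a b assume ab: "a \<in> carrier G" "b \<in> carrier G" "(a, b) \<in> E"
    have "t a = t b"
      using R_E[OF ab(3)] by (simp add: t_def)
    then have "(\<kappa> a \<otimes> t b, b) \<in> E"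
      using \<kappa>(2)[OF ab(1)] ab(3) E(3) by (metis transD)
    then show "\<kappa> a = \<kappa> b"
      by (rule uniq[OF \<kappa>(1)[OF ab(1)] \<kappa>(1)[OF ab(2)] tc[OF ab(2)] _ \<kappa>(2)[OF ab(2)]])
  qed (use \<kappa> in blast)
qed

section \<open>Periodic points\<close>

text \<open>A window pattern that agrees with a point of \<open>X\<close> is not forbidden. Hence
  \<open>locally_in\<close> yields local validity, and the FEP can be applied to total
  functions.\<close>

lemma (in group) FEP_E:
  assumes "FEP G A X"
  obtains W N where "finite W" "W \<subseteq> carrier G" "finite N" "N \<subseteq> carrier G" "\<one> \<in> N"
    and "\<And>D p. D \<subseteq> carrier G \<Longrightarrow> D \<noteq> {} \<Longrightarrow> locally_in G A X W (D <#> N) p \<Longrightarrow>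
      \<exists>z \<in> X. \<forall>d \<in> D. z d = p d"
proof -
  obtain W N where W: "window G A X W" and N: "N \<subseteq> carrier G" "finite N" "\<one> \<in> N"
    and ext: "\<forall>D \<subseteq> carrier G. D \<noteq> {} \<longrightarrow> (\<forall>p \<in> D \<rightarrow>\<^sub>E A.
      (\<exists>p'. locally_valid G A X W (D <#> N) p' \<and> p = restrict p' D) \<longrightarrow> globally_valid X D p)"
    using assms unfolding FEP_def by (elim conjE exE) (rule that)
  have W': "finite W" "W \<subseteq> carrier G"
    using W by (auto simp: window_def)
  show thesis
  proof (rule that[OF W' N(2,1,3)])
    fix D p assume D: "D \<subseteq> carrier G" "D \<noteq> {}" and p: "locally_in G A X W (D <#> N) p"
    have sub: "D \<subseteq> D <#> N"
      using D(1) N(3) by (force simp: set_mult_def)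
    have valid: "locally_valid G A X W (D <#> N) (restrict p (D <#> N))"
      unfolding locally_valid_def
    proof (intro conjI ballI notI)
      show "restrict p (D <#> N) \<in> (D <#> N) \<rightarrow>\<^sub>E A"
        using p by (auto simp: locally_in_def)
      fix q assume q: "q \<in> forbidden G A X W" and "appears G W q (D <#> N) (restrict p (D <#> N))"
      then obtain g where g: "g \<in> carrier G" "g <#\<^bsub>G\<^esub> W \<subseteq> D <#> N"
          "\<forall>w \<in> W. restrict p (D <#> N) (g \<otimes>\<^bsub>G\<^esub> w) = q w"
        by (auto simp: appears_def)
      then have E: "\<forall>w \<in> W. g \<otimes>\<^bsub>G\<^esub> w \<in> D <#> N"
        by (auto simp: l_coset_def)
      then obtain z where z: "z \<in> X" "\<forall>w \<in> W. p (g \<otimes>\<^bsub>G\<^esub> w) = z (g \<otimes>\<^bsub>G\<^esub> w)"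
        using p g(1) unfolding locally_in_def by blast
      have "appears G W q (carrier G) z"
        unfolding appears_def
      proof (intro bexI conjI)
        show "g <#\<^bsub>G\<^esub> W \<subseteq> carrier G"
          using g(1) W'(2) by (auto simp: l_coset_def)
      qed (use g z E in auto)
      then show False
        using q z by (auto simp: forbidden_def)
    qed
    have "restrict p D \<in> D \<rightarrow>\<^sub>E A"
      using p sub by (auto simp: locally_in_def)
    moreover have "restrict p D = restrict (restrict p (D <#> N)) D"
      using sub by (auto simp: restrict_def fun_eq_iff)
    ultimately have "globally_valid X D (restrict p D)"
      using ext[rule_format, OF D] valid by blast
    then obtain z where "z \<in> X" "restrict p D = restrict z D"
      by (auto simp: globally_valid_def)
    then show "\<exists>z \<in> X. \<forall>d \<in> D. z d = p d"
      by (metis restrict_apply')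
  qed
qed

text \<open>Basic open sets of the product topology constrain finitely many coordinates, so this is
  density in pointwise form.\<close>

lemma (in group) FEP_periodic_point:
  assumes rf: "residually_finite G"
    and d: "\<And>r. \<exists>m. \<exists>x \<in> bounded_colorings G S (d + 1) r m. periodic G x"
    and X: "subshift G A X" "FEP G A X"
    and x: "x \<in> X" and F: "finite F" "F \<subseteq> carrier G"
  obtains y where "y \<in> X" "periodic G y" "\<And>f. f \<in> F \<Longrightarrow> y f = x f"
proof -
  have XA: "X \<subseteq> carrier G \<rightarrow>\<^sub>E A"
    using X(1) closedin_subset by (fastforce simp: subshift_def config_topology_def)
  have Xs: "\<And>g x. g \<in> carrier G \<Longrightarrow> x \<in> X \<Longrightarrow> shift G g x \<in> X"
    using X(1) by (simp add: subshift_def)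
  have sub_mult: "D \<subseteq> D <#> N" if "D \<subseteq> carrier G" "\<one> \<in> N" for D N
    using that by (force simp: set_mult_def)

  \<comment> \<open>Neighborhoods and the displacement set \<open>Q\<close>\<close>
  obtain W N where W: "finite W" "W \<subseteq> carrier G" and N: "finite N" "N \<subseteq> carrier G" "\<one> \<in> N"
    and extend: "\<And>D p. D \<subseteq> carrier G \<Longrightarrow> D \<noteq> {} \<Longrightarrow> locally_in G A X W (D <#> N) p \<Longrightarrow>
      \<exists>z \<in> X. \<forall>d \<in> D. z d = p d"
    by (fact FEP_E[OF X(2)])
  define n where "n = Suc d"
  \<comment> \<open>\<open>B i\<close> is the product of \<open>i\<close> factors \<open>N\<close>.
    Each color costs one factor, so a start with \<open>B n\<close> leaves
    \<open>B 0 = {\<one>}\<close> after the last of the \<open>n\<close> colors.\<close>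
  define B where "B i = ((\<lambda>C. C <#> N) ^^ i) {\<one>}" for i :: nat
  have B_0: "B 0 = {\<one>}" and B_Suc: "\<And>i. B (Suc i) = B i <#> N"
    by (simp_all add: B_def)
  have B: "B i \<subseteq> carrier G" "finite (B i)" "\<one> \<in> B i" for i
  proof (induction i)
    case (Suc i)
    case 1 show ?case using Suc N by (simp add: B_Suc set_mult_closed)
    case 2 show ?case using Suc N by (simp add: B_Suc set_mult_def)
    case 3 show ?case using Suc N by (force simp: B_Suc set_mult_def)
  qed (simp_all add: B_0)
  define M where "M = (\<Union>i \<le> n. B i)"
  have M: "M \<subseteq> carrier G" "finite M" "\<one> \<in> M"
    using B by (auto simp: M_def)
  define V where "V = insert \<one> W"
  have V: "V \<subseteq> carrier G" "finite V"
    using W by (auto simp: V_def)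
  \<comment> \<open>\<open>Q\<close> contains \<open>inv a \<otimes> a'\<close> whenever the
    neighborhoods of \<open>a\<close> and \<open>a'\<close> meet the same translate of the window.
    The \<open>\<one>\<close> in \<open>V\<close> also covers neighborhoods that share a
    point.\<close>
  define Q where "Q = (\<lambda>(b, v, w, c). b \<otimes> (inv v \<otimes> w) \<otimes> inv c) ` (M \<times> V \<times> V \<times> M)"
  have Q_I: "b \<otimes> (inv v \<otimes> w) \<otimes> inv c \<in> Q" if "b \<in> M" "c \<in> M" "v \<in> V" "w \<in> V" for b c v w
    using that unfolding Q_def by force
  have Q_I': "b \<otimes> inv c \<in> Q" if "b \<in> M" "c \<in> M" for b c
  proof -
    have "b \<in> carrier G"
      using that M by blast
    then show ?thesis
      using Q_I[OF that, of \<one> \<one>] by (simp add: V_def)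
  qed
  have Q: "finite Q" "Q \<subseteq> carrier G"
    using M V by (auto simp: Q_def intro!: m_closed)
  have Q_one: "\<one> \<in> Q"
    using Q_I'[OF M(3) M(3)] by simp
  have Q_inv: "inv q \<in> Q" if q: "q \<in> Q" for q
  proof -
    obtain b v w c where *: "b \<in> M" "v \<in> V" "w \<in> V" "c \<in> M" "q = b \<otimes> (inv v \<otimes> w) \<otimes> inv c"
      using q by (auto simp: Q_def)
    then have "b \<in> carrier G" "v \<in> carrier G" "w \<in> carrier G" "c \<in> carrier G"
      using M V by auto
    then have "inv q = c \<otimes> (inv w \<otimes> v) \<otimes> inv b"
      using * by (simp add: inv_mult_group m_assoc)
    then show ?thesis
      using Q_I * by simp
  qed

  \<comment> \<open>The periodic coloring and its cells\<close>
  define r where "r = Max (word_norm G S ` Q)"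
  obtain m c where c: "c \<in> bounded_colorings G S n r m" "periodic G c"
    using d[of r] by (auto simp: n_def)
  have c_color: "c a \<in> {1..n}" if "a \<in> carrier G" for a
    using c(1) that by (auto simp: bounded_colorings_def)
  define H where "H = stabilizer G (shift G) c"
  have H: "finite_index G H"
    using c(2) by (simp add: periodic_def H_def)
  then have Hc: "k \<in> carrier G" if "k \<in> H" for k
    using that by (auto simp: finite_index_def dest: subgroup.mem_carrier)
  have Hinv: "c (k \<otimes> h) = c h" if k: "k \<in> H" and h: "h \<in> carrier G" for k h
  proof -
    have "c (k \<otimes> h) = shift G k c (k \<otimes> h)"
      using k by (simp add: H_def stabilizer_def)
    then show ?thesis
      using Hc[OF k] h by (simp add: shift_def inv_solve_left m_assoc[symmetric])
  qed
  \<comment> \<open>The cells are the classes of \<open>e\<^sup>*\<close>. Since \<open>r\<close>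
    bounds the word norm on \<open>Q\<close>, paths of \<open>e\<close> are paths of
    \<open>color_edges\<close>, so every cell lies in a finite component of the coloring.\<close>
  define e where "e = {(a, b). a \<in> carrier G \<and> b \<in> carrier G \<and> c a = c b \<and> inv a \<otimes> b \<in> Q}"
  have e_H: "(k \<otimes> a, k \<otimes> b) \<in> e" if "k \<in> H" "(a, b) \<in> e" for k a b
  proof -
    have ab: "a \<in> carrier G" "b \<in> carrier G"
      using that(2) by (auto simp: e_def)
    have "inv (k \<otimes> a) \<otimes> (k \<otimes> b) = inv a \<otimes> (inv k \<otimes> (k \<otimes> b))"
      using Hc[OF that(1)] ab by (simp add: inv_mult_group m_assoc)
    also have "inv k \<otimes> (k \<otimes> b) = b"
      using Hc[OF that(1)] ab by (simp add: m_assoc[symmetric])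
    finally show ?thesis
      using that Hc Hinv ab by (auto simp: e_def)
  qed
  have E_H: "(k \<otimes> a, k \<otimes> b) \<in> e\<^sup>*" if "k \<in> H" "(a, b) \<in> e\<^sup>*" for k a b
    using that(2) by (induction rule: rtrancl_induct) (auto intro: rtrancl_into_rtrancl e_H[OF that(1)])
  have "(b, a) \<in> e" if "(a, b) \<in> e" for a b
  proof -
    have "a \<in> carrier G" "b \<in> carrier G" "inv (inv a \<otimes> b) \<in> Q"
      using that Q_inv by (auto simp: e_def)
    then show ?thesis
      using that by (simp add: e_def inv_mult_group)
  qed
  then have E_sym: "sym (e\<^sup>*)"
    by (auto intro: sym_rtrancl symI)
  have E_color: "b \<in> carrier G \<and> c b = c a \<and> (a, b) \<in> (color_edges G S r c (c a))\<^sup>*"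
    if "(a, b) \<in> e\<^sup>*" "a \<in> carrier G" for a b
    using that(1)
  proof (induction rule: rtrancl_induct)
    case (step b b')
    have "word_norm G S (inv b \<otimes> b') \<le> r"
      using step(2) Q(1) by (auto simp: e_def r_def)
    then have "(b, b') \<in> color_edges G S r c (c a)"
      using step by (auto simp: e_def color_edges_def)
    then show ?case
      using step by (auto simp: e_def intro: rtrancl_into_rtrancl)
  qed (use that in simp)
  have E_fin: "finite (e\<^sup>* `` {a})" if "a \<in> carrier G" for a
  proof (rule finite_subset)
    show "e\<^sup>* `` {a} \<subseteq> (color_edges G S r c (c a))\<^sup>* `` {a}"
      using E_color that by auto
    show "finite ((color_edges G S r c (c a))\<^sup>* `` {a})"
      using c(1) that c_color[OF that] unfolding bounded_colorings_def by blast
  qed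
  \<comment> \<open>If \<open>k\<close> moves \<open>a\<close> into its own cell, then the conjugate
    \<open>inv a \<otimes> k \<otimes> a\<close> lies in \<open>T\<close>. It also lies in the
    normal subgroup \<open>L\<close> when \<open>k\<close> does, so avoiding \<open>T\<close> makes
    the action on cells free.\<close>
  define T where "T = {inv a \<otimes> b |a b. a \<in> carrier G \<and> (a, b) \<in> e\<^sup>*}"
  have T: "finite T" "T \<subseteq> carrier G"
    using finite_cell_displacements[OF H E_H E_fin] E_color by (auto simp: T_def)

  \<comment> \<open>The subgroup \<open>K\<close>\<close>
  define F' where "F' = insert \<one> F"
  \<comment> \<open>If \<open>k \<otimes> f\<close> and \<open>l \<otimes> g\<close> have
    displacement \<open>q\<close> in \<open>Q\<close>, then
    \<open>inv k \<otimes> l = f \<otimes> q \<otimes> inv g\<close>. Avoiding \<open>T'\<close>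
    therefore separates distinct translates of \<open>F'\<close>.\<close>
  define T' where "T' = (\<lambda>(f, q, g). f \<otimes> q \<otimes> inv g) ` (F' \<times> Q \<times> F')"
  have F': "finite F'" "F' \<subseteq> carrier G"
    using F by (auto simp: F'_def)
  have "finite (T \<union> T')" "T \<union> T' \<subseteq> carrier G"
    using T F' Q by (auto simp: T'_def intro!: m_closed)
  then obtain L where L: "L \<lhd> G" "finite_index G (H \<inter> L)" "L \<inter> (T \<union> T') \<subseteq> {\<one>}"
    using residually_finite_avoid[OF rf H] by blast
  define K where "K = H \<inter> L"
  have K_fin: "finite_index G K"
    using L(2) by (simp add: K_def)
  then have K: "subgroup K G"
    by (simp add: finite_index_def)
  note Kc = subgroup.mem_carrier[OF K] and Ki = subgroup.m_inv_closed[OF K]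
    and Km = subgroup.m_closed[OF K] and K1 = subgroup.one_closed[OF K]
  have KH: "k \<in> H" and KL: "k \<in> L" if "k \<in> K" for k
    using that by (auto simp: K_def)
  have free: "k = \<one>" if k: "k \<in> K" and a: "a \<in> carrier G" and ka: "(a, k \<otimes> a) \<in> e\<^sup>*" for k a
  proof -
    have kc: "k \<in> carrier G"
      using k Kc by blast
    have "inv a \<otimes> (k \<otimes> a) \<in> T"
      using a ka by (auto simp: T_def)
    moreover have "inv a \<otimes> k \<otimes> a \<in> L"
      using normal.inv_op_closed1[OF L(1) a KL[OF k]] .
    then have "inv a \<otimes> (k \<otimes> a) \<in> L"
      using a kc by (simp add: m_assoc)
    ultimately have 1: "inv a \<otimes> (k \<otimes> a) = \<one>"
      using L(3) by blast
    have "k = a \<otimes> (inv a \<otimes> (k \<otimes> a)) \<otimes> inv a"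
      using a kc by (simp add: m_assoc) (simp add: m_assoc[symmetric])
    then show ?thesis
      using 1 a by simp
  qed
  have E_K: "(k \<otimes> a, k \<otimes> b) \<in> e\<^sup>*" if "k \<in> K" "(a, b) \<in> e\<^sup>*" for k a b
    by (rule E_H[OF KH[OF that(1)] that(2)])
  obtain \<kappa> where \<kappa>: "\<And>a. a \<in> carrier G \<Longrightarrow> \<kappa> a \<in> K"
      "\<And>k a. k \<in> K \<Longrightarrow> a \<in> carrier G \<Longrightarrow> \<kappa> (k \<otimes> a) = k \<otimes> \<kappa> a"
      "\<And>a b. a \<in> carrier G \<Longrightarrow> b \<in> carrier G \<Longrightarrow> (a, b) \<in> e\<^sup>* \<Longrightarrow> \<kappa> a = \<kappa> b"
    by (rule cell_marking[OF K refl_rtrancl E_sym trans_rtrancl];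
        ((rule E_K; assumption) | (rule free; assumption) | (rule that; assumption)))

  \<comment> \<open>Induction over the colors\<close>
  define U where "U i = {k \<otimes> f |k f. k \<in> K \<and> f \<in> F'} \<union> {a \<in> carrier G. c a \<in> {1..i}}" for i
  have U_0: "U 0 = {k \<otimes> f |k f. k \<in> K \<and> f \<in> F'}"
    by (simp add: U_def)
  have U_Suc: "U (Suc i) = U i \<union> {a \<in> carrier G. c a = Suc i}" for i
    by (auto simp: U_def)
  have Uc: "U i \<subseteq> carrier G" for i
    using Kc F' by (auto simp: U_def intro!: m_closed)
  have F'U: "f \<in> U i" if "f \<in> F'" for f i
  proof -
    have "f = \<one> \<otimes> f"
      using that F' by auto
    then show ?thesis
      using that K1 unfolding U_def by blast
  qed
  have KU: "k \<otimes> u \<in> U i" if k: "k \<in> K" and u: "u \<in> U i" for k u i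
    using u unfolding U_def
  proof
    assume "u \<in> {a \<in> carrier G. c a \<in> {1..i}}"
    then show "k \<otimes> u \<in> {k \<otimes> f |k f. k \<in> K \<and> f \<in> F'} \<union> {a \<in> carrier G. c a \<in> {1..i}}"
      using k Kc Hinv[OF KH] by auto
  next
    assume "u \<in> {k \<otimes> f |k f. k \<in> K \<and> f \<in> F'}"
    then obtain l f where lf: "l \<in> K" "f \<in> F'" "u = l \<otimes> f"
      by auto
    then have "k \<otimes> u = (k \<otimes> l) \<otimes> f" "f \<in> carrier G"
      using k Kc F' by (auto simp: m_assoc)
    then show "k \<otimes> u \<in> {k \<otimes> f |k f. k \<in> K \<and> f \<in> F'} \<union> {a \<in> carrier G. c a \<in> {1..i}}"
      using k lf Km by blast
  qed
  have far: "k = l" if kl: "k \<in> K" "l \<in> K" and fg: "f \<in> F'" "g \<in> F'"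
    and q: "inv (k \<otimes> f) \<otimes> (l \<otimes> g) \<in> Q" for k l f g
  proof -
    have cs: "k \<in> carrier G" "l \<in> carrier G" "f \<in> carrier G" "g \<in> carrier G"
      using kl fg Kc F' by auto
    have "f \<otimes> (inv (k \<otimes> f) \<otimes> (l \<otimes> g)) \<otimes> inv g = f \<otimes> (inv f \<otimes> (inv k \<otimes> (l \<otimes> (g \<otimes> inv g))))"
      using cs by (simp add: inv_mult_group m_assoc)
    also have "\<dots> = inv k \<otimes> l"
      using cs by (simp add: m_assoc[symmetric])
    finally have "inv k \<otimes> l \<in> T'"
      using fg q unfolding T'_def by force
    then have "inv k \<otimes> l = \<one>"
      using L(3) KL[OF Km[OF Ki[OF kl(1)] kl(2)]] by blast
    then show ?thesis
      using cs by (metis inv_equality inv_inv inv_closed)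
  qed
  have B_M: "B (n - i) \<subseteq> M" for i
    unfolding M_def by (rule UN_upper) simp
  have Q_B: "b \<otimes> inv c \<in> Q" if "b \<in> B (n - i)" "c \<in> B (n - i)" for b c i
    by (rule Q_I'[OF subsetD[OF B_M that(1)] subsetD[OF B_M that(2)]])
  have Q_BW: "b \<otimes> (inv v \<otimes> w) \<otimes> inv c \<in> Q"
    if "b \<in> B (n - i)" "c \<in> B (n - i)" "v \<in> W" "w \<in> W" for b c v w i
    using Q_I[OF subsetD[OF B_M that(1)] subsetD[OF B_M that(2)]] that(3,4) by (simp add: V_def)
  have F'UB: "f \<in> U i <#> B j" if "f \<in> F'" for f i j
    using F'U[OF that, of i] B(3)[of j] F'(2) that by (force simp: set_mult_def)
  \<comment> \<open>After \<open>i\<close> colors the pattern is controlled on a neighborhood with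
    \<open>n - i\<close> factors \<open>N\<close> still to spend. Colors start at 1, so
    \<open>U 0\<close> holds only the translates of \<open>F'\<close>, while \<open>U n\<close> is
    the whole group.\<close>
  have "\<exists>p. (\<forall>f \<in> F'. p f = x f) \<and>
      (\<forall>k \<in> K. \<forall>h \<in> U i <#> B (n - i). p (k \<otimes> h) = p h) \<and>
      locally_in G A X W (U i <#> B (n - i)) p" if "i \<le> n" for i
    using that
  proof (induction i)
    case 0
    \<comment> \<open>The translates of \<open>F'\<close> serve as the cells of the first round,
      with marking \<open>\<mu>\<close>. The mark is unique by \<open>far\<close>, applied to the
      displacement \<open>\<one>\<close>.\<close>
    define \<mu> where "\<mu> a = (SOME k. k \<in> K \<and> (\<exists>f \<in> F'. a = k \<otimes> f))" for a
    have \<mu>: "\<mu> (k \<otimes> f) = k" if "k \<in> K" "f \<in> F'" for k f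
    proof -
      have "\<exists>l. l \<in> K \<and> (\<exists>g \<in> F'. k \<otimes> f = l \<otimes> g)"
        using that by blast
      then have "\<mu> (k \<otimes> f) \<in> K \<and> (\<exists>g \<in> F'. k \<otimes> f = \<mu> (k \<otimes> f) \<otimes> g)"
        unfolding \<mu>_def by (rule someI_ex)
      then obtain g where g: "\<mu> (k \<otimes> f) \<in> K" "g \<in> F'" "k \<otimes> f = \<mu> (k \<otimes> f) \<otimes> g"
        by blast
      have "k \<otimes> f \<in> carrier G"
        using that Kc F' by auto
      then have "inv (k \<otimes> f) \<otimes> (\<mu> (k \<otimes> f) \<otimes> g) \<in> Q"
        using g(3) Q_one by (metis l_inv)
      then show ?thesis
        using far[OF that(1) g(1) that(2) g(2)] by simp
    qed
    have \<mu>_K: "\<mu> (k \<otimes> a) = k \<otimes> \<mu> a" if k: "k \<in> K" and a: "a \<in> U 0" for k a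
    proof -
      obtain l f where lf: "l \<in> K" "f \<in> F'" "a = l \<otimes> f"
        using a by (auto simp: U_0)
      then have "k \<otimes> a = (k \<otimes> l) \<otimes> f"
        using k Kc F' by (auto simp: m_assoc)
      then show ?thesis
        using \<mu> lf k Km by simp
    qed
    have \<mu>_Q: "\<mu> a = \<mu> b" if ab: "a \<in> U 0" "b \<in> U 0" and q: "inv a \<otimes> b \<in> Q" for a b
    proof -
      obtain k f l g where *: "k \<in> K" "f \<in> F'" "a = k \<otimes> f" "l \<in> K" "g \<in> F'" "b = l \<otimes> g"
        using ab by (auto simp: U_0)
      then have "k = l"
        using far[OF *(1,4,2,5)] q by simp
      then show ?thesis
        using * \<mu> by simp
    qed
    have \<mu>_in: "\<mu> a \<in> K" if "a \<in> U 0" for a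
      using that \<mu> by (auto simp: U_0)
    \<comment> \<open>The old domain is empty here, so the conditions on the old pattern are vacuous
      and \<open>x\<close> itself is the point to copy.\<close>
    obtain p where p: "\<And>a b. a \<in> U 0 \<Longrightarrow> b \<in> B (n - 0) \<Longrightarrow> p (a \<otimes> b) = x (inv (\<mu> a) \<otimes> (a \<otimes> b))"
      "\<And>k h. k \<in> K \<Longrightarrow> h \<in> ({} \<union> U 0) <#> B (n - 0) \<Longrightarrow> p (k \<otimes> h) = p h"
      "locally_in G A X W (({} \<union> U 0) <#> B (n - 0)) p"
      by (rule extend_over_cells[where U = "{}" and V = "U 0" and B = "B (n - 0)" and z = x
            and p = x and \<kappa> = \<mu>, OF K XA Xs empty_subsetI Uc B(1) W(2) _ KU x _ _ \<mu>_in \<mu>_K \<mu>_Q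
            Q_B Q_BW];
          (assumption | (rule that; assumption) | simp add: set_mult_def))
    have "p f = x f" if f: "f \<in> F'" for f
    proof -
      have "f \<in> carrier G"
        using f F' by blast
      then show ?thesis
        using p(1)[OF F'U[OF f] B(3)] \<mu>[OF K1 f] by simp
    qed
    then show ?case
      using p(2,3) by auto
  next
    case (Suc i)
    then obtain p where p: "\<And>f. f \<in> F' \<Longrightarrow> p f = x f"
      "\<And>k h. k \<in> K \<Longrightarrow> h \<in> U i <#> B (n - i) \<Longrightarrow> p (k \<otimes> h) = p h"
      "locally_in G A X W (U i <#> B (n - i)) p"
      by auto
    let ?B = "B (n - Suc i)" and ?V = "{a \<in> carrier G. c a = Suc i}"
    \<comment> \<open>The factor \<open>N\<close> split off here is the margin that the FEP consumes
      in producing \<open>z\<close>.\<close>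
    have "B (n - i) = ?B <#> N"
      using Suc.prems B_Suc[of "n - Suc i"] by (simp add: Suc_diff_Suc)
    then have UB: "U i <#> B (n - i) = (U i <#> ?B) <#> N"
      using set_mult_assoc[OF Uc B(1) N(2)] by simp
    have UBc: "U i <#> ?B \<subseteq> carrier G"
      using set_mult_closed[OF Uc B(1)] .
    \<comment> \<open>The FEP asks for a nonempty domain; \<open>\<one>\<close> was put into
      \<open>F'\<close> to guarantee this even for empty \<open>F\<close>.\<close>
    have "U i <#> ?B \<noteq> {}"
      using F'UB[of \<one>] by (auto simp: F'_def)
    then obtain z where z: "z \<in> X" "\<And>h. h \<in> U i <#> ?B \<Longrightarrow> z h = p h"
      using extend[OF UBc _ p(3)[unfolded UB]] by blast
    have "U i <#> ?B \<subseteq> U i <#> B (n - i)"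
      unfolding UB by (rule sub_mult[OF UBc N(3)])
    then have p_inv: "p (k \<otimes> h) = p h" if "k \<in> K" "h \<in> U i <#> ?B" for k h
      using p(2) that by blast
    have KV: "k \<otimes> v \<in> ?V" if "k \<in> K" "v \<in> ?V" for k v
      using that Kc Hinv[OF KH] by auto
    have Vc: "?V \<subseteq> carrier G"
      by auto
    \<comment> \<open>Within one color, a displacement in \<open>Q\<close> is an edge of
      \<open>e\<close>, so both points lie in one cell.\<close>
    have \<kappa>_Q: "\<kappa> a = \<kappa> b" if "a \<in> ?V" "b \<in> ?V" "inv a \<otimes> b \<in> Q" for a b
    proof -
      have "(a, b) \<in> e"
        using that by (simp add: e_def)
      then show ?thesis
        using \<kappa>(3)[of a b] that(1,2) by auto
    qed
    obtain p' where p': "\<And>h. h \<in> U i <#> ?B \<Longrightarrow> p' h = p h"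
      "\<And>k h. k \<in> K \<Longrightarrow> h \<in> (U i \<union> ?V) <#> ?B \<Longrightarrow> p' (k \<otimes> h) = p' h"
      "locally_in G A X W ((U i \<union> ?V) <#> ?B) p'"
      by (rule extend_over_cells[where U = "U i" and V = ?V and B = ?B and z = z and p = p
            and \<kappa> = \<kappa>, OF K XA Xs Uc Vc B(1) W(2) KU KV z p_inv \<kappa>(1)[OF subsetD[OF Vc]]
            \<kappa>(2)[OF _ subsetD[OF Vc]] \<kappa>_Q Q_B Q_BW];
          (assumption | (rule that; assumption)))
    have "p' f = x f" if "f \<in> F'" for f
      using p'(1)[OF F'UB[OF that]] p(1)[OF that] by simp
    then show ?case
      using p'(2,3) unfolding U_Suc by blast
  qed
  from this[OF order_refl] obtain p where p: "\<And>f. f \<in> F' \<Longrightarrow> p f = x f"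
    "\<And>k h. k \<in> K \<Longrightarrow> h \<in> U n <#> B 0 \<Longrightarrow> p (k \<otimes> h) = p h"
    "locally_in G A X W (U n <#> B 0) p"
    by auto
  have "U n = carrier G"
    using Uc[of n] c_color by (auto simp: U_def)
  then have UB: "U n <#> B 0 = carrier G"
    by (force simp: B_0 set_mult_def)
  \<comment> \<open>On the whole group no margin is lost, so a last use of the FEP makes the pattern
    a point of \<open>X\<close>.\<close>
  have "carrier G <#> N = carrier G"
    using set_mult_closed[OF subset_refl N(2)] sub_mult[OF subset_refl N(3)] by blast
  then have "locally_in G A X W (carrier G <#> N) p"
    using p(3) UB by simp
  then obtain y where y: "y \<in> X" "\<And>h. h \<in> carrier G \<Longrightarrow> y h = p h"
    using extend[OF subset_refl carrier_not_empty] by blast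

  \<comment> \<open>Periodicity of \<open>y\<close>\<close>
  have "periodic G y"
  proof -
    have y_ext: "y \<in> extensional (carrier G)"
      using y(1) XA by (auto simp: PiE_def)
    have y_K: "y (k \<otimes> h) = y h" if "k \<in> K" "h \<in> carrier G" for k h
      using that y(2) p(2) UB Kc by simp
    let ?M = "stabilizer G (shift G) y"
    have one: "shift G \<one> y = y"
      using y_ext by (auto simp: shift_def fun_eq_iff extensional_def)
    have mult: "shift G (g \<otimes> h) y = shift G g (shift G h y)"
      if "g \<in> carrier G" "h \<in> carrier G" for g h
      using that by (auto simp: shift_def fun_eq_iff inv_mult_group m_assoc)
    have stab: "subgroup ?M G"
    proof (rule subgroupI)
      fix g assume "g \<in> stabilizer G (shift G) y"
      then have g: "g \<in> carrier G" "shift G g y = y"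
        by (auto simp: stabilizer_def)
      then have "shift G (inv g) y = shift G (inv g \<otimes> g) y"
        using mult[of "inv g" g] by simp
      then show "inv g \<in> stabilizer G (shift G) y"
        using g one by (simp add: stabilizer_def)
    qed (use one mult in \<open>auto simp: stabilizer_def\<close>)
    have fin: "finite (rcosets K)"
      using K_fin by (simp add: finite_index_def)
    have KM: "K \<subseteq> ?M"
      using y_ext y_K Kc Ki
      by (auto simp: stabilizer_def shift_def fun_eq_iff extensional_def)
    \<comment> \<open>Each coset of the larger subgroup \<open>?M\<close> is determined by a coset
      of \<open>K\<close>, so finite index passes from \<open>K\<close> to
      \<open>?M\<close>.\<close>
    have "?M #> a = ?M <#> (K #> a)" if a: "a \<in> carrier G" for a
    proof
      show "?M #> a \<subseteq> ?M <#> (K #> a)"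
        using a K1
        by (force simp: r_coset_def set_mult_def)
      show "?M <#> (K #> a) \<subseteq> ?M #> a"
      proof
        fix b assume "b \<in> ?M <#> (K #> a)"
        then obtain m h where mh: "m \<in> ?M" "h \<in> K" "b = m \<otimes> (h \<otimes> a)"
          by (auto simp: r_coset_def set_mult_def)
        then have "b = (m \<otimes> h) \<otimes> a" "m \<otimes> h \<in> ?M"
          using a KM subgroup.mem_carrier[OF stab] by (auto simp: m_assoc subsetD[OF KM] subgroup.m_closed[OF stab])
        then show "b \<in> ?M #> a"
          by (auto simp: r_coset_def)
      qed
    qed
    then have "rcosets ?M \<subseteq> (\<lambda>C. ?M <#> C) ` (rcosets K)"
      by (auto simp: RCOSETS_def)
    then show ?thesis
      using fin stab by (auto simp: periodic_def finite_index_def intro: finite_subset)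
  qed
  moreover have "y f = x f" if "f \<in> F" for f
    using that p(1) y(2) F by (auto simp: F'_def)
  ultimately show thesis
    using that y(1) by blast
qed

theorem theorem6p18:
  fixes G :: "('g, 'm) monoid_scheme" and S :: "'g set"
    and A :: "'a set" and X :: "('g \<Rightarrow> 'a) set"
  assumes "group G"
    and "infinite (carrier G)"
    and "residually_finite G"
    and "finite_symmetric_generating_set G S"
    and "pdim G S < \<infinity>"
    and "finite A"
    and "subshift G A X"
    and "FEP G A X"
  shows "dense_periodic_points G A X"
proof -
  \<comment> \<open>In \<open>enat\<close> the infimum of the empty set is
    \<open>\<infinity>\<close>, so finite dimension provides some \<open>d\<close>.\<close>
  have "{d. \<forall>r. \<exists>m. \<exists>x \<in> bounded_colorings G S (d + 1) r m. periodic G x} \<noteq> {}"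
  proof
    assume "{d. \<forall>r. \<exists>m. \<exists>x \<in> bounded_colorings G S (d + 1) r m. periodic G x} = {}"
    then have "pdim G S = \<infinity>"
      unfolding pdim_def by (simp only: image_empty Inf_enat_def if_True simp_thms)
    then show False
      using assms(5) by simp
  qed
  then obtain d where d: "\<And>r. \<exists>m. \<exists>x \<in> bounded_colorings G S (d + 1) r m. periodic G x"
    by blast
  let ?T = "config_topology G A" and ?P = "{x \<in> X. periodic G x}"
  have XT: "X \<subseteq> topspace ?T"
    using assms(7) closedin_subset by (auto simp: subshift_def)
  have "\<exists>y \<in> ?P. y \<in> Z" if x: "x \<in> X" "x \<in> Z" and Z: "openin ?T Z" for x Z
  proof -
    \<comment> \<open>The box \<open>U\<close> has finitely many proper factors, and their
      coordinates form the finite set on which \<open>y\<close> must agree with \<open>x\<close>. At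
      the other coordinates the factor is all of \<open>A\<close>.\<close>
    obtain U where U: "finite {i \<in> carrier G. U i \<noteq> A}" "x \<in> Pi\<^sub>E (carrier G) U"
        "Pi\<^sub>E (carrier G) U \<subseteq> Z"
      using Z x(2) unfolding config_topology_def openin_product_topology_alt by fastforce
    obtain y where y: "y \<in> X" "periodic G y" "\<And>i. i \<in> carrier G \<Longrightarrow> U i \<noteq> A \<Longrightarrow> y i = x i"
      by (rule group.FEP_periodic_point[OF assms(1,3) d assms(7,8) x(1) U(1)]; (blast | (rule that; simp)))
    have "y \<in> carrier G \<rightarrow>\<^sub>E A"
      using y(1) XT by (auto simp: config_topology_def)
    then have "y \<in> Pi\<^sub>E (carrier G) U"
      using U(2) y(3) unfolding PiE_iff by metis
    then have "y \<in> Z"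
      by (rule subsetD[OF U(3)])
    then show ?thesis
      using y(1,2) by auto
  qed
  then have "X \<subseteq> (?T closure_of ?P)"
    using XT by (auto simp: in_closure_of)
  then show ?thesis
    unfolding dense_periodic_points_def by (auto simp: closure_of_subtopology Int_absorb1)
qed

end
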